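(* Let $\mathbb K\in\{\mathbb R,\mathbb C\}$, let $\Omega_{\mathbb K}\subset\mathbb K$, let $K(z,w)$ be a positive definite $\mathbf B(\ell_2(\mathbb N_0))$-valued kernel on $\Omega_{\mathbb K}$, and let $K(z,w)=\Gamma(z)\Gamma(w)^*$ be a minimal factorization of $K$ via a Hilbert space $\mathcal G$. Let $\mathcal A$ be a topological algebra over $\mathbb K$ with topological dual $\mathcal A'$, both endowed with involutions as described in the context. For $f\in\mathcal G$ and $z\in\Omega_{\mathbb K}$ write $\Gamma(z)f=(f_n(z))_{n=0}^\infty\in\ell_2(\mathbb N_0)$. Then the series $$F(z,\mathbf A)=\sum_{n=0}^\infty A_nf_n(z)$$ is weakly convergent on the set of sequences $\mathbf A=(A_n)_{n=0}^\infty$ of elements of $\mathcal A$ such that $X(a,\mathbf A)\in\ell_2(\mathbb N_0)$ for all $a\in\mathcal A'$; that is, for every such $\mathbf A$, every $z\in\Omega_{\mathbb K}$, every $f\in\mathcal G$ and every $a\in\mathcal A'$, the limit $\lim_{N\to\infty}\big\langle a,\sum_{n=0}^NA_nf_n(z)\big\rangle$ exists in $\mathbb K$.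
   Context: $\ell_2(\mathbb N_0)$ is the Hilbert space of square-summable $\mathbb K$-valued sequences indexed by $\mathbb N_0=\{0,1,2,\dots\}$; inner products are linear in the first variable. $\mathbf B(\mathcal H_1,\mathcal H_2)$ denotes bounded linear operators, $\mathbf B(\mathcal H)=\mathbf B(\mathcal H,\mathcal H)$. An operator-valued function $K:\Omega_{\mathbb K}\times\Omega_{\mathbb K}\to\mathbf B(\ell_2(\mathbb N_0))$ is positive definite if the scalar function $((z,f),(w,e))\mapsto\langle K(z,w)e,f\rangle_{\ell_2(\mathbb N_0)}$ is positive definite (a Hermitian positive semidefinite kernel) on $\Omega_{\mathbb K}\times\ell_2(\mathbb N_0)$. A minimal factorization $K(z,w)=\Gamma(z)\Gamma(w)^*$ via $\mathcal G$ means that $\Gamma(z)\in\mathbf B(\mathcal G,\ell_2(\mathbb N_0))$ for every $z\in\Omega_{\mathbb K}$ and that the linear span of the ranges of the operators $\Gamma(w)^*$, $w\in\Omega_{\mathbb K}$, is dense in $\mathcal G$. A topological algebra is an algebra over $\mathbb K$ that is a locally convex topological vector space in which the product is separately continuous in each variable. $\langle a,A\rangle$ denotes the duality pairing of $a\in\mathcal A'$ and $A\in\mathcal A$. $\mathcal A$ and $\mathcal A'$ carry involutions $A\mapsto A^*$ and $a\mapsto a^*$ that extend complex conjugation, respect the algebraic structure, and satisfy $\overline{\langle a,A\rangle}=\langle a^*,A^*\rangle$. For $a\in\mathcal A'$ and a sequence $\mathbf A=(A_n)_{n=0}^\infty$ in $\mathcal A$, $X(a,\mathbf A)$ is the column $(\langle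 a,A_n^*\rangle)_{n=0}^\infty$. *)

theory Defs
  imports "HOL-Analysis.Analysis"
begin

section \<open>The scalar field: real or complex\<close>

(* The axiom rc_range says that the field is a copy of the reals or of the complex numbers; the
   other axioms say that this copy is algebraic, isometric and compatible with conjugation. *)
class rc_field = real_normed_field + banach +
  fixes to_complex :: "'a \<Rightarrow> complex"
    and rc_conj :: "'a \<Rightarrow> 'a"
  assumes to_complex_add: "to_complex (x + y) = to_complex x + to_complex y"
    and to_complex_mult: "to_complex (x * y) = to_complex x * to_complex y"
    and to_complex_scaleR: "to_complex (r *\<^sub>R x) = r *\<^sub>R to_complex x"
    and norm_to_complex: "norm (to_complex x) = norm x"
    and rc_range: "range to_complex = \<real> \<or> range to_complex = UNIV"
    and to_complex_conj: "to_complex (rc_conj x) = cnj (to_complex x)"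

instantiation real :: rc_field
begin

definition to_complex_real :: "real \<Rightarrow> complex" where "to_complex_real = complex_of_real"

definition rc_conj_real :: "real \<Rightarrow> real" where "rc_conj_real x = x"

instance
  by standard (simp_all add: to_complex_real_def rc_conj_real_def Reals_def scaleR_conv_of_real)

end

instantiation complex :: rc_field
begin

definition to_complex_complex :: "complex \<Rightarrow> complex" where "to_complex_complex z = z"

definition rc_conj_complex :: "complex \<Rightarrow> complex" where "rc_conj_complex = cnj"

instance
  by standard (auto simp: to_complex_complex_def rc_conj_complex_def)

end

lemma to_complex_zero: "to_complex 0 = 0"
  using to_complex_add[of 0 0] by simp

lemma to_complex_diff: "to_complex (x - y) = to_complex x - to_complex y"
  using to_complex_add[of "x - y" y] by (simp add: algebra_simps)

lemma to_complex_inject: "to_complex x = to_complex y \<longleftrightarrow> x = y"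
proof
  assume "to_complex x = to_complex y"
  then have "norm (x - y) = 0"
    using norm_to_complex[of "x - y"] by (simp add: to_complex_diff)
  then show "x = y" by simp
qed simp

lemma to_complex_one: "to_complex (1::'k::rc_field) = 1"
proof -
  have "to_complex (1::'k) * to_complex (1::'k) = to_complex (1::'k)"
    by (simp only: to_complex_mult[symmetric] mult_1)
  moreover have "to_complex (1::'k) \<noteq> 0"
    using to_complex_inject[of 1 "0::'k"] by (simp add: to_complex_zero)
  ultimately show ?thesis by simp
qed

lemma to_complex_of_real: "to_complex (of_real r :: 'k::rc_field) = of_real r"
proof -
  have "to_complex (of_real r :: 'k) = to_complex (r *\<^sub>R (1::'k))"
    by (simp only: of_real_def)
  also have "\<dots> = r *\<^sub>R 1"
    by (simp only: to_complex_scaleR to_complex_one)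
  finally show ?thesis
    by (simp only: of_real_def)
qed

lemma rc_conj_add: "rc_conj (x + y) = rc_conj x + rc_conj y"
  by (rule to_complex_inject[THEN iffD1]) (simp add: to_complex_add to_complex_conj)

lemma rc_conj_mult: "rc_conj (x * y) = rc_conj x * rc_conj y"
  by (rule to_complex_inject[THEN iffD1]) (simp add: to_complex_mult to_complex_conj)

lemma rc_conj_conj [simp]: "rc_conj (rc_conj x) = x"
  by (rule to_complex_inject[THEN iffD1]) (simp add: to_complex_conj)

lemma norm_conj [simp]: "norm (rc_conj x) = norm x"
  using norm_to_complex[of "rc_conj x"] by (simp add: to_complex_conj norm_to_complex)

lemma mult_conj: "x * rc_conj x = of_real ((norm x)\<^sup>2)"
  by (rule to_complex_inject[THEN iffD1])
    (simp only: to_complex_mult to_complex_conj to_complex_of_real complex_norm_square[symmetric]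
      norm_to_complex)

lemma bounded_linear_conj: "bounded_linear (rc_conj :: 'k::rc_field \<Rightarrow> 'k)"
proof (rule bounded_linear_intro[where K = 1])
  fix r :: real and x :: 'k
  show "rc_conj (r *\<^sub>R x) = r *\<^sub>R rc_conj x"
    by (rule to_complex_inject[THEN iffD1]) (simp add: to_complex_scaleR to_complex_conj)
qed (simp_all add: rc_conj_add)

section \<open>Vector spaces, Hilbert spaces and bounded operators over the scalar field\<close>

locale rc_vector_space = vector_space scale
  for scale :: "'k::rc_field \<Rightarrow> 'v::real_vector \<Rightarrow> 'v" +
  assumes scale_of_real: "scale (of_real r) x = r *\<^sub>R x"

(* Completeness is part of the class banach; the norm is the one given by the inner product. *)
locale hilbert_space = rc_vector_space scale
  for scale :: "'k::rc_field \<Rightarrow> 'v::banach \<Rightarrow> 'v" +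
  fixes ip :: "'v \<Rightarrow> 'v \<Rightarrow> 'k"
  assumes ip_add_left: "ip (x + y) z = ip x z + ip y z"
    and ip_scale_left: "ip (scale c x) y = c * ip x y"
    and ip_commute: "ip y x = rc_conj (ip x y)"
    and ip_self: "ip x x = of_real ((norm x)\<^sup>2)"

definition bounded_operator ::
    "('k::rc_field \<Rightarrow> 'v::real_normed_vector \<Rightarrow> 'v) \<Rightarrow> ('k \<Rightarrow> 'w::real_normed_vector \<Rightarrow> 'w)
      \<Rightarrow> ('v \<Rightarrow> 'w) \<Rightarrow> bool"
  where "bounded_operator scale1 scale2 T \<longleftrightarrow>
    Vector_Spaces.linear scale1 scale2 T \<and> bounded_linear T"

(* Well defined for bounded operators between Hilbert spaces, by the Riesz representation
   theorem. *)
definition hadjoint :: "('v \<Rightarrow> 'v \<Rightarrow> 'k) \<Rightarrow> ('w \<Rightarrow> 'w \<Rightarrow> 'k) \<Rightarrow> ('v \<Rightarrow> 'w) \<Rightarrow> 'w \<Rightarrow> 'v"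
  where "hadjoint ip1 ip2 T = (THE S. \<forall>x y. ip2 (T x) y = ip1 x (S y))"

section \<open>The Hilbert space of square-summable sequences\<close>

definition square_summable :: "(nat \<Rightarrow> 'k::rc_field) \<Rightarrow> bool"
  where "square_summable x \<longleftrightarrow> summable (\<lambda>n. (norm (x n))\<^sup>2)"

lemma square_summable_zero: "square_summable (\<lambda>n. 0)"
  by (simp add: square_summable_def)

lemma square_summable_add:
  assumes "square_summable x" "square_summable y"
  shows "square_summable (\<lambda>n. x n + y n)"
  unfolding square_summable_def
proof (rule summable_comparison_test')
  show "summable (\<lambda>n. 2 * (norm (x n))\<^sup>2 + 2 * (norm (y n))\<^sup>2)"
    using assms by (intro summable_add summable_mult) (auto simp: square_summable_def)
  fix n
  have "(norm (x n + y n))\<^sup>2 \<le> (norm (x n) + norm (y n))\<^sup>2"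
    by (intro power_mono norm_triangle_ineq) auto
  also have "\<dots> \<le> 2 * (norm (x n))\<^sup>2 + 2 * (norm (y n))\<^sup>2"
    using zero_le_power2[of "norm (x n) - norm (y n)"]
    by (simp add: power2_sum power2_diff)
  finally show "norm ((norm (x n + y n))\<^sup>2) \<le> 2 * (norm (x n))\<^sup>2 + 2 * (norm (y n))\<^sup>2"
    by simp
qed

lemma square_summable_scale:
  assumes "square_summable x"
  shows "square_summable (\<lambda>n. c * x n)"
  using summable_mult[of "\<lambda>n. (norm (x n))\<^sup>2" "(norm c)\<^sup>2"] assms
  by (simp add: square_summable_def norm_mult power_mult_distrib)

lemma square_summable_uminus: "square_summable x \<Longrightarrow> square_summable (\<lambda>n. - x n)"
  by (simp add: square_summable_def)

lemma square_summable_diff: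
  assumes "square_summable x" "square_summable y"
  shows "square_summable (\<lambda>n. x n - y n)"
  using square_summable_add[OF assms(1) square_summable_uminus[OF assms(2)]] by simp

lemma square_summable_scaleR:
  assumes "square_summable x"
  shows "square_summable (\<lambda>n. r *\<^sub>R x n)"
  using square_summable_scale[OF assms, of "of_real r"] by (simp add: scaleR_conv_of_real)

typedef (overloaded) 'k ell2 = "{x :: nat \<Rightarrow> 'k::rc_field. square_summable x}"
  morphisms ell2_nth Abs_ell2
  using square_summable_zero by blast

setup_lifting type_definition_ell2

lemma square_summable_ell2_nth: "square_summable (ell2_nth x)"
  using ell2_nth[of x] by simp

instantiation ell2 :: (rc_field) real_vector
begin

lift_definition zero_ell2 :: "'a ell2" is "\<lambda>n. 0"
  by (rule square_summable_zero)

lift_definition plus_ell2 :: "'a ell2 \<Rightarrow> 'a ell2 \<Rightarrow> 'a ell2" is "\<lambda>x y n. x n + y n"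
  by (rule square_summable_add)

lift_definition uminus_ell2 :: "'a ell2 \<Rightarrow> 'a ell2" is "\<lambda>x n. - x n"
  by (rule square_summable_uminus)

lift_definition minus_ell2 :: "'a ell2 \<Rightarrow> 'a ell2 \<Rightarrow> 'a ell2" is "\<lambda>x y n. x n - y n"
  by (rule square_summable_diff)

lift_definition scaleR_ell2 :: "real \<Rightarrow> 'a ell2 \<Rightarrow> 'a ell2" is "\<lambda>r x n. r *\<^sub>R x n"
  by (rule square_summable_scaleR)

instance
  by standard (transfer; simp add: fun_eq_iff algebra_simps)+

end

lift_definition scale_ell2 :: "'k::rc_field \<Rightarrow> 'k ell2 \<Rightarrow> 'k ell2" is "\<lambda>c x n. c * x n"
  by (rule square_summable_scale)

definition ip_ell2 :: "'k::rc_field ell2 \<Rightarrow> 'k ell2 \<Rightarrow> 'k"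
  where "ip_ell2 x y = (\<Sum>n. ell2_nth x n * rc_conj (ell2_nth y n))"

instantiation ell2 :: (rc_field) real_normed_vector
begin

definition norm_ell2 :: "'a ell2 \<Rightarrow> real"
  where "norm_ell2 x = sqrt (\<Sum>n. (norm (ell2_nth x n))\<^sup>2)"

definition sgn_ell2 :: "'a ell2 \<Rightarrow> 'a ell2"
  where "sgn_ell2 x = inverse (norm x) *\<^sub>R x"

definition dist_ell2 :: "'a ell2 \<Rightarrow> 'a ell2 \<Rightarrow> real"
  where "dist_ell2 x y = norm (x - y)"

definition uniformity_ell2 :: "('a ell2 \<times> 'a ell2) filter"
  where "uniformity_ell2 = (INF e\<in>{0<..}. principal {(x, y). dist x y < e})"

definition open_ell2 :: "'a ell2 set \<Rightarrow> bool"
  where "open_ell2 U = (\<forall>x\<in>U. \<forall>\<^sub>F (x', y) in uniformity. x' = x \<longrightarrow> y \<in> U)"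

lemma summable_ell2: "summable (\<lambda>n. (norm (ell2_nth x n))\<^sup>2)"
  using square_summable_ell2_nth[of x] by (simp add: square_summable_def)

lemma norm_ell2_nonneg: "0 \<le> norm (x :: 'a ell2)"
  by (simp add: norm_ell2_def suminf_nonneg summable_ell2)

lemma norm_ell2_power2: "(norm x)\<^sup>2 = (\<Sum>n. (norm (ell2_nth x n))\<^sup>2)"
  by (simp add: norm_ell2_def suminf_nonneg summable_ell2)

lemma L2_set_le_norm_ell2: "L2_set (\<lambda>n. norm (ell2_nth x n)) {..<N} \<le> norm x"
  unfolding L2_set_def norm_ell2_def
  by (intro real_sqrt_le_mono sum_le_suminf summable_ell2) auto

lemma norm_ell2_le:
  assumes "\<And>N. L2_set (\<lambda>n. norm (ell2_nth x n)) {..<N} \<le> C"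
  shows "norm x \<le> C"
proof -
  have C: "0 \<le> C" using assms[of 0] by simp
  have "(\<Sum>n<N. (norm (ell2_nth x n))\<^sup>2) \<le> C\<^sup>2" for N
    using assms[of N] unfolding L2_set_def by (rule sqrt_le_D)
  then have "(\<Sum>n. (norm (ell2_nth x n))\<^sup>2) \<le> C\<^sup>2"
    by (intro suminf_le_const summable_ell2)
  then show ?thesis
    unfolding norm_ell2_def using C by (rule real_le_lsqrt[rotated])
qed

lemma norm_ell2_nth_le: "norm (ell2_nth x n) \<le> norm x"
proof -
  have "norm (ell2_nth x n) \<le> L2_set (\<lambda>n. norm (ell2_nth x n)) {..<Suc n}"
    by (rule member_le_L2_set) auto
  also have "\<dots> \<le> norm x" by (rule L2_set_le_norm_ell2)
  finally show ?thesis .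
qed

instance
proof
  fix x y :: "'a ell2" and r :: real
  show "dist x y = norm (x - y)"
    by (rule dist_ell2_def)
  show "sgn x = inverse (norm x) *\<^sub>R x"
    by (rule sgn_ell2_def)
  show "uniformity = (INF e\<in>{0<..}. principal {(x, y :: 'a ell2). dist x y < e})"
    by (rule uniformity_ell2_def)
  show "open U = (\<forall>x\<in>U. \<forall>\<^sub>F (x', y) in uniformity. x' = x \<longrightarrow> y \<in> U)" for U :: "'a ell2 set"
    by (rule open_ell2_def)
  show "(norm x = 0) = (x = 0)"
  proof
    assume "norm x = 0"
    then have "ell2_nth x n = 0" for n
      using norm_ell2_nth_le[of x n] by simp
    then show "x = 0"
      by (simp add: ell2_nth_inject[symmetric] zero_ell2.rep_eq fun_eq_iff)
  next
    assume "x = 0"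
    then show "norm x = 0" by (simp add: norm_ell2_def zero_ell2.rep_eq)
  qed
  show "norm (x + y) \<le> norm x + norm y"
  proof (rule norm_ell2_le)
    fix N
    have "L2_set (\<lambda>n. norm (ell2_nth (x + y) n)) {..<N}
        \<le> L2_set (\<lambda>n. norm (ell2_nth x n) + norm (ell2_nth y n)) {..<N}"
      by (intro L2_set_mono) (auto simp: plus_ell2.rep_eq norm_triangle_ineq)
    also have "\<dots> \<le> L2_set (\<lambda>n. norm (ell2_nth x n)) {..<N} + L2_set (\<lambda>n. norm (ell2_nth y n)) {..<N}"
      by (rule L2_set_triangle_ineq)
    also have "\<dots> \<le> norm x + norm y"
      by (intro add_mono L2_set_le_norm_ell2)
    finally show "L2_set (\<lambda>n. norm (ell2_nth (x + y) n)) {..<N} \<le> norm x + norm y" .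
  qed
  show "norm (r *\<^sub>R x) = \<bar>r\<bar> * norm x"
    by (simp add: norm_ell2_def scaleR_ell2.rep_eq power_mult_distrib
        suminf_mult[OF summable_ell2] real_sqrt_mult)
qed

end

instance ell2 :: (rc_field) banach
proof
  fix X :: "nat \<Rightarrow> 'a ell2"
  assume X: "Cauchy X"
  have "Cauchy (\<lambda>m. ell2_nth (X m) n)" for n
  proof (rule CauchyI)
    fix e :: real assume "0 < e"
    then obtain M where M: "\<And>m k. m \<ge> M \<Longrightarrow> k \<ge> M \<Longrightarrow> norm (X m - X k) < e"
      using CauchyD[OF X] by blast
    have "norm (ell2_nth (X m) n - ell2_nth (X k) n) < e" if "m \<ge> M" "k \<ge> M" for m k
      using M[OF that] norm_ell2_nth_le[of "X m - X k" n] by (simp add: minus_ell2.rep_eq)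
    then show "\<exists>M. \<forall>m\<ge>M. \<forall>k\<ge>M. norm (ell2_nth (X m) n - ell2_nth (X k) n) < e" by blast
  qed
  then have "\<exists>l. (\<lambda>m. ell2_nth (X m) n) \<longlonglongrightarrow> l" for n
    by (simp add: Cauchy_convergent_iff convergent_def)
  then obtain L where L: "\<And>n. (\<lambda>m. ell2_nth (X m) n) \<longlonglongrightarrow> L n"
    by metis
  have bound: "L2_set (\<lambda>n. norm (ell2_nth (X m) n - L n)) {..<N} \<le> e"
    if M: "\<And>m k. m \<ge> M \<Longrightarrow> k \<ge> M \<Longrightarrow> norm (X m - X k) < e" and m: "m \<ge> M" for M m N e
  proof (rule LIMSEQ_le_const2)
    show "(\<lambda>k. L2_set (\<lambda>n. norm (ell2_nth (X m) n - ell2_nth (X k) n)) {..<N})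
        \<longlonglongrightarrow> L2_set (\<lambda>n. norm (ell2_nth (X m) n - L n)) {..<N}"
      unfolding L2_set_def by (intro tendsto_intros L)
    have "L2_set (\<lambda>n. norm (ell2_nth (X m) n - ell2_nth (X k) n)) {..<N} \<le> e" if "k \<ge> M" for k
      using L2_set_le_norm_ell2[of "X m - X k" N] M[OF m that] by (simp add: minus_ell2.rep_eq)
    then show "\<exists>K. \<forall>k\<ge>K. L2_set (\<lambda>n. norm (ell2_nth (X m) n - ell2_nth (X k) n)) {..<N} \<le> e"
      by blast
  qed
  obtain M where M: "\<And>m k. m \<ge> M \<Longrightarrow> k \<ge> M \<Longrightarrow> norm (X m - X k) < 1"
    using CauchyD[OF X, of 1] by auto
  have "(\<Sum>n<N. (norm (ell2_nth (X M) n - L n))\<^sup>2) \<le> 1\<^sup>2" for N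
    using bound[of M 1 M N, OF M] unfolding L2_set_def by (intro sqrt_le_D) simp
  then have "square_summable (\<lambda>n. ell2_nth (X M) n - L n)"
    unfolding square_summable_def by (intro summableI_nonneg_bounded[where x = 1]) auto
  from square_summable_diff[OF square_summable_ell2_nth[of "X M"] this]
  have "square_summable L" by simp
  then have L_nth: "ell2_nth (Abs_ell2 L) = L"
    by (simp add: Abs_ell2_inverse)
  have "X \<longlonglongrightarrow> Abs_ell2 L"
  proof (rule LIMSEQ_I)
    fix e :: real assume "0 < e"
    then obtain M where M: "\<And>m k. m \<ge> M \<Longrightarrow> k \<ge> M \<Longrightarrow> norm (X m - X k) < e / 2"
      using CauchyD[OF X, of "e / 2"] by auto
    have "norm (X m - Abs_ell2 L) \<le> e / 2" if "m \<ge> M" for m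
      using bound[OF M that] by (intro norm_ell2_le) (simp add: minus_ell2.rep_eq L_nth)
    moreover have "e / 2 < e" using \<open>0 < e\<close> by simp
    ultimately show "\<exists>M. \<forall>m\<ge>M. norm (X m - Abs_ell2 L) < e"
      using le_less_trans by blast
  qed
  then show "convergent X" by (auto simp: convergent_def)
qed

lemma summable_ip_ell2: "summable (\<lambda>n. ell2_nth x n * rc_conj (ell2_nth y n))"
proof (rule summable_comparison_test')
  show "summable (\<lambda>n. (norm (ell2_nth x n))\<^sup>2 + (norm (ell2_nth y n))\<^sup>2)"
    by (intro summable_add summable_ell2)
  fix n
  show "norm (ell2_nth x n * rc_conj (ell2_nth y n)) \<le> (norm (ell2_nth x n))\<^sup>2 + (norm (ell2_nth y n))\<^sup>2"
    using sum_squares_bound[of "norm (ell2_nth x n)" "norm (ell2_nth y n)"]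
      mult_nonneg_nonneg[OF norm_ge_zero norm_ge_zero, of "ell2_nth x n" "ell2_nth y n"]
    unfolding norm_mult norm_conj by linarith
qed

interpretation ell2: hilbert_space "scale_ell2 :: 'k::rc_field \<Rightarrow> 'k ell2 \<Rightarrow> 'k ell2" ip_ell2
proof
  fix x y z :: "'k ell2" and a b c :: 'k and r :: real
  show "scale_ell2 a (x + y) = scale_ell2 a x + scale_ell2 a y"
    by transfer (simp add: algebra_simps)
  show "scale_ell2 (a + b) x = scale_ell2 a x + scale_ell2 b x"
    by transfer (simp add: algebra_simps)
  show "scale_ell2 a (scale_ell2 b x) = scale_ell2 (a * b) x"
    by transfer (simp add: algebra_simps)
  show "scale_ell2 1 x = x"
    by transfer simp
  show "scale_ell2 (of_real r) x = r *\<^sub>R x"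
    by transfer (simp add: scaleR_conv_of_real)
  show "ip_ell2 (x + y) z = ip_ell2 x z + ip_ell2 y z"
    by (simp add: ip_ell2_def plus_ell2.rep_eq distrib_right suminf_add summable_ip_ell2)
  show "ip_ell2 (scale_ell2 c x) y = c * ip_ell2 x y"
    by (simp add: ip_ell2_def scale_ell2.rep_eq mult.assoc suminf_mult summable_ip_ell2)
  show "ip_ell2 y x = rc_conj (ip_ell2 x y)"
    unfolding ip_ell2_def
    by (subst bounded_linear.suminf[OF bounded_linear_conj summable_ip_ell2])
      (simp add: rc_conj_mult mult.commute)
  show "ip_ell2 x x = of_real ((norm x)\<^sup>2)"
    by (simp add: ip_ell2_def mult_conj norm_ell2_power2 suminf_of_real summable_ell2
        del: of_real_power)
qed

section \<open>Positive definite kernels and minimal factorizations\<close>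

(* Membership in the nonnegative reals means real and nonnegative also for complex scalars. *)
definition positive_definite_on :: "'x set \<Rightarrow> ('x \<Rightarrow> 'x \<Rightarrow> 'k::rc_field) \<Rightarrow> bool"
  where "positive_definite_on X k \<longleftrightarrow>
    (\<forall>x\<in>X. \<forall>y\<in>X. k y x = rc_conj (k x y)) \<and>
    (\<forall>(N::nat) x c. (\<forall>i<N. x i \<in> X) \<longrightarrow>
      (\<Sum>i<N. \<Sum>j<N. rc_conj (c i) * c j * k (x i) (x j)) \<in> \<real>\<^sub>\<ge>\<^sub>0)"

definition positive_definite_operator_kernel ::
    "'k::rc_field set \<Rightarrow> ('k \<Rightarrow> 'k \<Rightarrow> 'k ell2 \<Rightarrow> 'k ell2) \<Rightarrow> bool"
  where "positive_definite_operator_kernel \<Omega> K \<longleftrightarrow>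
    (\<forall>z\<in>\<Omega>. \<forall>w\<in>\<Omega>. bounded_operator scale_ell2 scale_ell2 (K z w)) \<and>
    positive_definite_on (\<Omega> \<times> UNIV) (\<lambda>(z, f) (w, e). ip_ell2 (K z w e) f)"

definition minimal_factorization ::
    "'k::rc_field set \<Rightarrow> ('k \<Rightarrow> 'k \<Rightarrow> 'k ell2 \<Rightarrow> 'k ell2)
      \<Rightarrow> ('k \<Rightarrow> 'g::banach \<Rightarrow> 'g) \<Rightarrow> ('g \<Rightarrow> 'g \<Rightarrow> 'k) \<Rightarrow> ('k \<Rightarrow> 'g \<Rightarrow> 'k ell2) \<Rightarrow> bool"
  where "minimal_factorization \<Omega> K scaleG ip \<Gamma> \<longleftrightarrow>
    (\<forall>z\<in>\<Omega>. bounded_operator scaleG scale_ell2 (\<Gamma> z)) \<and>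
    (\<forall>z\<in>\<Omega>. \<forall>w\<in>\<Omega>. K z w = \<Gamma> z \<circ> hadjoint ip ip_ell2 (\<Gamma> w)) \<and>
    closure (module.span scaleG (\<Union>w\<in>\<Omega>. range (hadjoint ip ip_ell2 (\<Gamma> w)))) = UNIV"

section \<open>Topological algebras with involution\<close>

locale topological_algebra = rc_vector_space scale
  for scale :: "'k::rc_field \<Rightarrow> 'a::{real_algebra, topological_ab_group_add} \<Rightarrow> 'a" +
  assumes scale_mult_left: "scale c x * y = scale c (x * y)"
    and scale_mult_right: "x * scale c y = scale c (x * y)"
    and continuous_scale: "continuous_on UNIV (\<lambda>(c, x). scale c x)"
    and locally_convex: "open U \<Longrightarrow> (0::'a) \<in> U \<Longrightarrow>
      \<exists>V. open V \<and> convex V \<and> 0 \<in> V \<and> V \<subseteq> U"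
    and continuous_mult_left: "continuous_on UNIV (\<lambda>x::'a. x * y)"
    and continuous_mult_right: "continuous_on UNIV (\<lambda>y::'a. x * y)"

definition topological_dual ::
    "('k::rc_field \<Rightarrow> 'a::{ab_group_add, topological_space} \<Rightarrow> 'a) \<Rightarrow> ('a \<Rightarrow> 'k) set"
  where "topological_dual scaleA = {a. Vector_Spaces.linear scaleA (*) a \<and> continuous_on UNIV a}"

(* star is the involution of the algebra and dstar that of its dual; the pairing of a functional a
   with an element x is a x. Conjugate-linearity is what extending the conjugation of scalars
   means; for a unital algebra it gives star (scale c 1) = scale (rc_conj c) 1. *)
locale involutive_topological_algebra = topological_algebra scale
  for scale :: "'k::rc_field \<Rightarrow> 'a::{real_algebra, topological_ab_group_add} \<Rightarrow> 'a" +
  fixes star :: "'a \<Rightarrow> 'a" and dstar :: "('a \<Rightarrow> 'k) \<Rightarrow> ('a \<Rightarrow> 'k)"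
  assumes star_star: "star (star x) = x"
    and star_add: "star (x + y) = star x + star y"
    and star_scale: "star (scale c x) = scale (rc_conj c) (star x)"
    and star_mult: "star (x * y) = star y * star x"
    and dstar_dual: "a \<in> topological_dual scale \<Longrightarrow> dstar a \<in> topological_dual scale"
    and dstar_dstar: "a \<in> topological_dual scale \<Longrightarrow> dstar (dstar a) = a"
    and dstar_add: "a \<in> topological_dual scale \<Longrightarrow> b \<in> topological_dual scale \<Longrightarrow>
      dstar (\<lambda>x. a x + b x) = (\<lambda>x. dstar a x + dstar b x)"
    and dstar_scale: "a \<in> topological_dual scale \<Longrightarrow>
      dstar (\<lambda>x. c * a x) = (\<lambda>x. rc_conj c * dstar a x)"
    and pairing_star: "a \<in> topological_dual scale \<Longrightarrow> rc_conj (a x) = dstar a (star x)"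

definition pairing_column :: "('a \<Rightarrow> 'a) \<Rightarrow> ('a \<Rightarrow> 'k) \<Rightarrow> (nat \<Rightarrow> 'a) \<Rightarrow> nat \<Rightarrow> 'k"
  where "pairing_column star a A = (\<lambda>n. a (star (A n)))"

end

theory Submission
  imports Defs
begin

text \<open>
  Pairing the series with a functional \<open>a\<close> turns it into a scalar series that is an inner product
  in \<open>\<ell>\<^sub>2\<close>. Since \<open>a\<close> is linear, the pairing of a partial sum with \<open>a\<close> is the partial sum of
  \<open>f\<^sub>n(z) \<langle>a, A\<^sub>n\<rangle>\<close>. The rule \<open>\<langle>a, A\<^sub>n\<rangle> = conj \<langle>a\<^sup>*, A\<^sub>n\<^sup>*\<rangle>\<close> identifies \<open>\<langle>a, A\<^sub>n\<rangle>\<close> with the conjugate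
  of the \<open>n\<close>-th entry of the column \<open>X(a\<^sup>*, A)\<close>. Because \<open>a\<^sup>*\<close> is again a continuous functional,
  that column is square-summable, and the Cauchy-Schwarz inequality gives convergence, with
  \<open>\<langle>\<Gamma>(z) f, X(a\<^sup>*, A)\<rangle>\<close> as the limit. This is why square-summability is
  assumed for all functionals at once: the column that enters is that of \<open>a\<^sup>*\<close>, not that of \<open>a\<close>.
\<close>

lemma (in involutive_topological_algebra) pairing_eq_conj_pairing_column:
  assumes "a \<in> topological_dual scale"
  shows "a (A n) = rc_conj (pairing_column star (dstar a) A n)"
  unfolding pairing_column_def pairing_star[OF assms, symmetric] by simp

lemma dual_pairing_sum_scale:
  assumes "a \<in> topological_dual scaleA"
  shows "a (\<Sum>n\<in>I. scaleA (c n) (A n)) = (\<Sum>n\<in>I. c n * a (A n))"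
proof -
  from assms interpret Vector_Spaces.linear scaleA "(*)" a
    by (simp add: topological_dual_def)
  show ?thesis by (simp add: sum scale)
qed

text \<open>
  The limit is named explicitly: by the conjugation rule, the pairing with \<open>a\<close> of the \<open>N\<close>-th partial
  sum is the \<open>N\<close>-th partial sum of the series that defines this inner product.
\<close>

lemma (in involutive_topological_algebra) pairing_partial_sums_tendsto_ip_ell2:
  assumes a: "a \<in> topological_dual scale"
    and column: "square_summable (pairing_column star (dstar a) A)"
  shows "(\<lambda>N. a (\<Sum>n\<le>N. scale (ell2_nth x n) (A n)))
    \<longlonglongrightarrow> ip_ell2 x (Abs_ell2 (pairing_column star (dstar a) A))"
proof -
  let ?y = "Abs_ell2 (pairing_column star (dstar a) A)"
  have "ell2_nth ?y n = pairing_column star (dstar a) A n" for n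
    using column by (simp add: Abs_ell2_inverse)
  then have "a (\<Sum>n\<le>N. scale (ell2_nth x n) (A n))
      = (\<Sum>n\<le>N. ell2_nth x n * rc_conj (ell2_nth ?y n))" for N
    by (simp add: dual_pairing_sum_scale[OF a] pairing_eq_conj_pairing_column[OF a])
  then show ?thesis
    using summable_LIMSEQ'[OF summable_ip_ell2[of x ?y]] by (simp add: ip_ell2_def)
qed

theorem proposition2p3:
  fixes \<Omega> :: "'k::rc_field set"
    and K :: "'k \<Rightarrow> 'k \<Rightarrow> 'k ell2 \<Rightarrow> 'k ell2"
    and scaleG :: "'k \<Rightarrow> 'g::banach \<Rightarrow> 'g"
    and ipG :: "'g \<Rightarrow> 'g \<Rightarrow> 'k"
    and \<Gamma> :: "'k \<Rightarrow> 'g \<Rightarrow> 'k ell2"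
    and scaleA :: "'k \<Rightarrow> 'a::{real_algebra, topological_ab_group_add} \<Rightarrow> 'a"
    and star :: "'a \<Rightarrow> 'a"
    and dstar :: "('a \<Rightarrow> 'k) \<Rightarrow> ('a \<Rightarrow> 'k)"
  assumes "positive_definite_operator_kernel \<Omega> K"
    and "hilbert_space scaleG ipG"
    and "minimal_factorization \<Omega> K scaleG ipG \<Gamma>"
    and "involutive_topological_algebra scaleA star dstar"
  shows "\<forall>A :: nat \<Rightarrow> 'a.
    (\<forall>a\<in>topological_dual scaleA. square_summable (pairing_column star a A)) \<longrightarrow>
    (\<forall>z\<in>\<Omega>. \<forall>f. \<forall>a\<in>topological_dual scaleA.
      convergent (\<lambda>N. a (\<Sum>n\<le>N. scaleA (ell2_nth (\<Gamma> z f) n) (A n))))"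
proof (intro allI impI ballI)
  interpret involutive_topological_algebra scaleA star dstar by fact
  fix A :: "nat \<Rightarrow> 'a" and z f a
  assume columns: "\<forall>a\<in>topological_dual scaleA. square_summable (pairing_column star a A)"
    and a: "a \<in> topological_dual scaleA"
  have "square_summable (pairing_column star (dstar a) A)"
    using columns dstar_dual[OF a] by blast
  from pairing_partial_sums_tendsto_ip_ell2[OF a this]
  show "convergent (\<lambda>N. a (\<Sum>n\<le>N. scaleA (ell2_nth (\<Gamma> z f) n) (A n)))"
    by (rule convergentI)
qed

end
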